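(* Let $P_n$ be the path on $n$ vertices. Then $\mathrm{USN}(P_n) = O(\log n)$ as $n\to\infty$; that is, there exist constants $C>0$ and $n_0$ such that $\mathrm{USN}(P_n)\le C\log n$ for all $n\ge n_0$.
   Context: Graphs are finite, simple and undirected. A valid labelling of a graph $G$ with universe a finite set $S$ assigns to the vertices of $G$ pairwise distinct nonempty subsets of $S$ such that two distinct vertices are adjacent if and only if their labels are disjoint. The universe size number $\mathrm{USN}(G)$ is the minimum of $|S|$ over all finite sets $S$ for which $G$ has a valid labelling with universe $S$. *)

theory Defs
  imports Complex_Main "Graph_Theory.Pair_Digraph"
begin

text \<open>
  A finite simple undirected graph is a \<^locale>\<open>pair_graph\<close>, that is, a finite, loop-free digraph
  whose arc set is symmetric; an edge between \<open>u\<close> and \<open>v\<close> is represented by the two arcs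
  \<open>(u, v)\<close> and \<open>(v, u)\<close>.
\<close>

definition valid_labelling :: "'a pair_pre_digraph \<Rightarrow> 's set \<Rightarrow> ('a \<Rightarrow> 's set) \<Rightarrow> bool" where
  "valid_labelling G S f \<longleftrightarrow>
     (\<forall>v\<in>pverts G. f v \<subseteq> S \<and> f v \<noteq> {}) \<and>
     inj_on f (pverts G) \<and>
     (\<forall>u\<in>pverts G. \<forall>v\<in>pverts G. u \<noteq> v \<longrightarrow> ((u, v) \<in> parcs G \<longleftrightarrow> f u \<inter> f v = {}))"

text \<open>
  Universes are taken to be finite sets of naturals; the lemmas \<open>USN_le\<close> and \<open>USN_attained\<close> below show
  that this is no restriction and that the minimum exists for every graph.
\<close>

definition USN :: "'a pair_pre_digraph \<Rightarrow> nat" where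
  "USN G = (LEAST k. \<exists>(S :: nat set) f. finite S \<and> card S = k \<and> valid_labelling G S f)"

definition path_graph :: "nat \<Rightarrow> nat pair_pre_digraph" where
  "path_graph n = \<lparr> pverts = {..<n},
     parcs = {(i, j). i < n \<and> j < n \<and> (j = Suc i \<or> i = Suc j)} \<rparr>"

lemma pair_graph_path_graph: "pair_graph (path_graph n)"
proof
  have "parcs (path_graph n) \<subseteq> {..<n} \<times> {..<n}"
    by (auto simp: path_graph_def)
  then show "finite (parcs (path_graph n))"
    by (rule finite_subset) simp
  show "symmetric (with_proj (path_graph n))"
    by (auto simp: path_graph_def symmetric_def arcs_ends_def arc_to_ends_def sym_def)
qed (auto simp: path_graph_def)

lemma valid_labelling_transfer:
  assumes "valid_labelling G S f" "inj_on h S"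
  shows "valid_labelling G (h ` S) (\<lambda>v. h ` f v)"
proof -
  have sub: "f v \<subseteq> S" if "v \<in> pverts G" for v
    using assms(1) that by (auto simp: valid_labelling_def)
  have "inj_on (\<lambda>v. h ` f v) (pverts G)"
    using assms sub unfolding valid_labelling_def inj_on_def
    by (metis (no_types, lifting) assms(2) inj_on_image_eq_iff)
  moreover have "h ` f u \<inter> h ` f v = {} \<longleftrightarrow> f u \<inter> f v = {}"
    if "u \<in> pverts G" "v \<in> pverts G" for u v
    using inj_on_image_Int[OF assms(2) sub[OF that(1)] sub[OF that(2)]] by (metis image_is_empty)
  ultimately show ?thesis
    using assms(1) sub unfolding valid_labelling_def by (simp add: image_mono)
qed

lemma USN_le:
  fixes S :: "'s set"
  assumes "finite S" "valid_labelling G S f"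
  shows "USN G \<le> card S"
proof -
  obtain h :: "'s \<Rightarrow> nat" where h: "inj_on h S"
    using finite_imp_inj_to_nat_seg[OF assms(1)] by blast
  show ?thesis
    unfolding USN_def
    using valid_labelling_transfer[OF assms(2) h] assms(1) card_image[OF h]
    by (intro Least_le) blast
qed

text \<open>Existence: label \<open>v\<close> by \<open>{v}\<close> together with all pairs \<open>{v, w}\<close> such that \<open>w\<close> is not a neighbour of \<open>v\<close>.\<close>

lemma (in pair_graph) ex_valid_labelling:
  "\<exists>(S :: 'a set set) f. finite S \<and> valid_labelling G S f"
proof (intro exI conjI)
  let ?f = "\<lambda>v. insert {v} {{v, w} |w. w \<in> pverts G \<and> (v, w) \<notin> parcs G}"
  have sym: "(v, u) \<in> parcs G" if "(u, v) \<in> parcs G" for u v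
    using that arcs_symmetric by blast
  show "finite (Pow (pverts G))" by simp
  show "valid_labelling G (Pow (pverts G)) ?f"
    unfolding valid_labelling_def
  proof (intro conjI ballI impI)
    show "inj_on ?f (pverts G)"
    proof (rule inj_onI)
      fix u v assume "?f u = ?f v"
      then have "{u} \<in> ?f v" by blast
      then show "u = v" by auto
    qed
  next
    fix u v assume uv: "u \<in> pverts G" "v \<in> pverts G" "u \<noteq> v"
    show "(u, v) \<in> parcs G \<longleftrightarrow> ?f u \<inter> ?f v = {}"
    proof
      assume *: "(u, v) \<in> parcs G"
      show "?f u \<inter> ?f v = {}"
        using * sym[OF *] uv by (auto simp: doubleton_eq_iff)
    next
      assume *: "?f u \<inter> ?f v = {}"
      show "(u, v) \<in> parcs G"
      proof (rule ccontr)
        assume "(u, v) \<notin> parcs G"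
        moreover from this have "(v, u) \<notin> parcs G" using sym by blast
        ultimately have "{u, v} \<in> ?f u" "{v, u} \<in> ?f v" using uv by blast+
        then have "{u, v} \<in> ?f u \<inter> ?f v" by (simp add: insert_commute)
        then show False using * by blast
      qed
    qed
  qed auto
qed

lemma USN_attained:
  assumes "pair_graph G"
  shows "\<exists>(S :: nat set) f. finite S \<and> card S = USN G \<and> valid_labelling G S f"
proof -
  obtain S :: "'a set set" and f where S: "finite S" "valid_labelling G S f"
    using pair_graph.ex_valid_labelling[OF assms] by blast
  obtain h :: "'a set \<Rightarrow> nat" where "inj_on h S"
    using finite_imp_inj_to_nat_seg[OF S(1)] by blast
  then have "\<exists>k. \<exists>(S :: nat set) f. finite S \<and> card S = k \<and> valid_labelling G S f"
    using valid_labelling_transfer[OF S(2)] S(1) by blast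
  then show ?thesis
    unfolding USN_def by (rule LeastI_ex)
qed

end

theory Submission
  imports Defs
begin

text \<open>
  Labelling a vertex by the members of a family of independent sets that contain it, one sees that
  \<open>USN\<close> of a long path is at most the size of any family of independent sets such that every
  two nonadjacent vertices lie in a common member. Such a family of logarithmic size comes from
  binary expansions: two vertices \<open>i < j\<close> are separated at a unique dyadic scale \<open>2 ^ k\<close>, where they
  lie in the left and right half of a common block of length \<open>2 ^ Suc k\<close>. At each scale, prescribe
  the parity of the chosen vertices in left and in right halves, and restrict to every other block,
  so that edges between different blocks do no harm. The only edges that remain possible join the
  two halves of a block; they are destroyed by omitting one of their end points, which for
  nonadjacent \<open>i\<close>, \<open>j\<close> can be chosen different from both.
\<close>

lemma USN_path_graph_le_card_cover:
  fixes A :: "'x \<Rightarrow> nat set"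
  assumes "n \<ge> 4" "finite X"
    and indep: "\<And>x v. x \<in> X \<Longrightarrow> v \<in> A x \<Longrightarrow> Suc v \<notin> A x"
    and cover: "\<And>i j. i + 2 \<le> j \<Longrightarrow> j < n \<Longrightarrow> \<exists>x\<in>X. i \<in> A x \<and> j \<in> A x"
  shows "USN (path_graph n) \<le> card X"
proof (rule USN_le[OF \<open>finite X\<close>])
  define f where "f v = {x \<in> X. v \<in> A x}" for v
  have meet: "f i \<inter> f j \<noteq> {}" if "i + 2 \<le> j \<or> j + 2 \<le> i" "i < n" "j < n" for i j
    using that cover unfolding f_def by blast
  have disjoint: "f v \<inter> f (Suc v) = {}" for v
    using indep by (auto simp: f_def)
  have nonempty: "f v \<noteq> {}" if "v < n" for v
  proof -
    have "\<exists>w<n. v + 2 \<le> w \<or> w + 2 \<le> v"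
      using that \<open>n \<ge> 4\<close> by presburger
    then show ?thesis using meet that by blast
  qed
  have distinct: "f u \<noteq> f v" if uv: "u < v" "v < n" for u v
  proof
    assume eq: "f u = f v"
    show False
    proof (cases "v = Suc u")
      case True
      then show False using eq disjoint[of u] nonempty[of v] uv by simp
    next
      case False
      \<comment> \<open>Each case supplies a vertex adjacent to exactly one of \<open>u\<close>,
        \<open>v\<close> and distinct from both: \<open>Suc v\<close>, \<open>v - 1\<close> and
        \<open>u - 1\<close>.\<close>
      consider "Suc v < n" | "Suc v = n" "u + 3 \<le> v" | "Suc v = n" "v = u + 2" "u \<ge> 1"
        using False uv \<open>n \<ge> 4\<close> by linarith
      then show False
      proof cases
        case 1
        then show False using eq meet[of u "Suc v"] disjoint[of v] uv by simp
      next
        case 2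
        then show False using eq meet[of u "v - 1"] disjoint[of "v - 1"] uv by (auto simp: Int_commute)
      next
        case 3
        then show False using eq meet[of v "u - 1"] disjoint[of "u - 1"] uv by (auto simp: Int_commute)
      qed
    qed
  qed
  have "inj_on f {..<n}"
    by (rule linorder_inj_onI) (use distinct in auto)
  moreover have "(v = Suc u \<or> u = Suc v) \<longleftrightarrow> f u \<inter> f v = {}"
    if "u < n" "v < n" "u \<noteq> v" for u v
  proof
    assume "v = Suc u \<or> u = Suc v"
    then show "f u \<inter> f v = {}" using disjoint by (auto simp: Int_commute)
  next
    assume "f u \<inter> f v = {}"
    then have "\<not> (u + 2 \<le> v \<or> v + 2 \<le> u)" using meet that by blast
    then show "v = Suc u \<or> u = Suc v" using that by linarith
  qed
  ultimately show "valid_labelling (path_graph n) X f"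
    using nonempty by (auto simp: valid_labelling_def path_graph_def f_def)
qed

text \<open>\<open>b\<close> selects alternate blocks, \<open>l\<close> and \<open>r\<close> are the
  parities in left and right halves; \<open>d\<close> omits the last vertex of each left half,
  \<open>\<not> d\<close> the first of each right half.\<close>

definition dyadic_set :: "nat \<times> bool \<times> bool \<times> bool \<times> bool \<Rightarrow> nat set" where
  "dyadic_set = (\<lambda>(k, b, l, r, d). {v. even (v div 2 ^ Suc k) = b \<and>
     (if even (v div 2 ^ k)
      then even v = l \<and> (d \<longrightarrow> \<not> 2 ^ k dvd Suc v)
      else even v = r \<and> (\<not> d \<longrightarrow> \<not> 2 ^ k dvd v))})"

lemma Suc_notin_dyadic_set:
  assumes "v \<in> dyadic_set x"
  shows "Suc v \<notin> dyadic_set x"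
proof
  assume Suc_in: "Suc v \<in> dyadic_set x"
  obtain k b l r d where x: "x = (k, b, l, r, d)" by (cases x)
  note in_x = assms[unfolded x dyadic_set_def] Suc_in[unfolded x dyadic_set_def]
  show False
  proof (cases "2 ^ k dvd Suc v")
    case False
    then have "Suc v div 2 ^ k = v div 2 ^ k"
      by (simp add: div_Suc dvd_eq_mod_eq_0)
    then show False using in_x by (auto split: if_splits)
  next
    case True
    then have "Suc v div 2 ^ k = Suc (v div 2 ^ k)"
      by (simp add: div_Suc dvd_eq_mod_eq_0)
    moreover have "w div 2 ^ Suc k = w div 2 ^ k div 2" for w :: nat
      by (metis div_mult2_eq power_Suc2)
    \<comment> \<open>\<open>Suc v\<close> starts a new half: either the edge crosses the middle of
      a block, where \<open>d\<close> removes an end, or it enters the next block, which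
      \<open>b\<close> excludes.\<close>
    ultimately have "even (v div 2 ^ k) \<or>
        even (Suc v div 2 ^ Suc k) \<noteq> even (v div 2 ^ Suc k)"
      by (cases "even (v div 2 ^ k)") (auto simp del: power_Suc elim!: oddE)
    then show False
      using in_x True \<open>Suc v div 2 ^ k = Suc (v div 2 ^ k)\<close>
      by (auto simp del: power_Suc split: if_splits)
  qed
qed

text \<open>The quotients differ at exponent 0 and both vanish at exponent \<open>L\<close>, so they
  first agree somewhere in between.\<close>

lemma dyadic_separation:
  fixes i j :: nat
  assumes "i < j" "j < 2 ^ L"
  shows "\<exists>k<L. i div 2 ^ Suc k = j div 2 ^ Suc k \<and> i div 2 ^ k \<noteq> j div 2 ^ k"
proof -
  define P where "P m \<longleftrightarrow> i div 2 ^ m = j div 2 ^ m" for m :: nat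
  have "P L" "\<not> P 0" using assms by (auto simp: P_def)
  then have "\<exists>k<L. \<not> P k \<and> P (Suc k)"
    using ex_least_nat_less[of P L] by blast
  then show ?thesis by (auto simp: P_def)
qed

lemma dyadic_set_cover:
  assumes "i + 2 \<le> j" "j < 2 ^ L"
  shows "\<exists>x\<in>{..<L} \<times> UNIV. i \<in> dyadic_set x \<and> j \<in> dyadic_set x"
proof -
  obtain k where k: "k < L" "i div 2 ^ Suc k = j div 2 ^ Suc k" "i div 2 ^ k \<noteq> j div 2 ^ k"
    using dyadic_separation[of i j L] assms by auto
  have "i div 2 ^ k \<le> j div 2 ^ k" using assms by (simp add: div_le_mono)
  moreover have "i div 2 ^ k div 2 = j div 2 ^ k div 2"
    using k(2) by (metis div_mult2_eq power_Suc2)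
  ultimately have halves: "even (i div 2 ^ k)" "j div 2 ^ k = Suc (i div 2 ^ k)"
    using k(3) by (cases "even (i div 2 ^ k)"; cases "even (j div 2 ^ k)"; auto elim!: evenE oddE)+
  \<comment> \<open>Otherwise \<open>i\<close> ends the left half and \<open>j\<close> starts the
    right one, making them adjacent.\<close>
  have "\<not> (2 ^ k dvd Suc i \<and> 2 ^ k dvd j)"
  proof
    assume "2 ^ k dvd Suc i \<and> 2 ^ k dvd j"
    then have "Suc i div 2 ^ k = j div 2 ^ k" "2 ^ k dvd Suc i" "2 ^ k dvd j"
      using halves by (simp_all add: div_Suc dvd_eq_mod_eq_0)
    then have "Suc i = j" by (metis dvd_div_mult_self)
    then show False using assms by simp
  qed
  then show ?thesis
    using k halves
    \<comment> \<open>The last entry omits the left end point unless that is \<open>i\<close>; then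
      the right one goes, which is not \<open>j\<close>.\<close>
    by (intro bexI[of _ "(k, even (i div 2 ^ Suc k), even i, even j, \<not> 2 ^ k dvd Suc i)"])
       (auto simp: dyadic_set_def)
qed

lemma USN_path_graph_le_log:
  assumes "n \<ge> 4" "n \<le> 2 ^ L"
  shows "USN (path_graph n) \<le> 16 * L"
proof -
  have "USN (path_graph n) \<le> card ({..<L} \<times> (UNIV :: (bool \<times> bool \<times> bool \<times> bool) set))"
    using assms dyadic_set_cover Suc_notin_dyadic_set
    by (intro USN_path_graph_le_card_cover[where A = dyadic_set]) auto
  then show ?thesis
    by (simp add: card_cartesian_product flip: UNIV_Times_UNIV)
qed

theorem theorem10:
  shows "\<exists>C > (0 :: real). \<exists>n\<^sub>0 :: nat. \<forall>n \<ge> n\<^sub>0. real (USN (path_graph n)) \<le> C * ln (real n)"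
proof (intro exI conjI allI impI)
  \<comment> \<open>There are 16 Boolean choices per scale; rounding the logarithm up at most
    doubles it, as it is at least 1.\<close>
  show "32 / ln 2 > (0 :: real)" by simp
next
  fix n :: nat
  assume n: "n \<ge> 4"
  define L where "L = nat \<lceil>log 2 (real n)\<rceil>"
  have log_ge: "log 2 (real n) \<ge> 1" using n by simp
  then have L: "log 2 (real n) \<le> real L" "real L \<le> 2 * log 2 (real n)"
    unfolding L_def by linarith+
  have "real n = 2 powr log 2 (real n)" using n by simp
  also have "\<dots> \<le> 2 powr real L" using L(1) by (intro powr_mono) auto
  also have "\<dots> = real (2 ^ L)" by (simp add: powr_realpow)
  finally have "n \<le> 2 ^ L" using of_nat_le_iff by blast
  then have "real (USN (path_graph n)) \<le> real (16 * L)"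
    using USN_path_graph_le_log[OF n] of_nat_le_iff by blast
  also have "\<dots> \<le> 32 * log 2 (real n)" using L(2) by simp
  finally show "real (USN (path_graph n)) \<le> 32 / ln 2 * ln (real n)"
    by (simp add: log_def)
qed

end
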